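(* Let $\mathcal G$ be an eager-scope $\lambda$-ap-ho-term-graph over $\Sigma^\lambda_1$. Let $\mathcal S$ be the set of isomorphism classes of $\lambda$-ap-ho-term-graphs $\mathcal G'$ over $\Sigma^\lambda_1$ such that there is a homomorphism (of $\lambda$-ap-ho-term-graphs) from $\mathcal G$ to $\mathcal G'$. Order $\mathcal S$ by $[\mathcal G_1]\preceq[\mathcal G_2]$ iff there is a homomorphism from $\mathcal G_1$ to $\mathcal G_2$. Then $(\mathcal S,\preceq)$ is a complete lattice.
   Context: Term graphs. A term graph over a signature $\Sigma$ (symbols with arities $\mathrm{ar}$) is a tuple $(V,\mathit{lab},\mathit{args},r)$, where: - $V$ is a set of vertices; - $\mathit{lab}:V\to\Sigma$; - $\mathit{args}:V\to V^*$ with $|\mathit{args}(v)|=\mathrm{ar}(\mathit{lab}(v))$; - $r$ is the root, and every vertex is reachable from $r$. Write $w\rightarrowtail_k w'$ if $w'$ is the $k$-th entry (from $0$) of $\mathit{args}(w)$, and $w\rightarrowtail w'$ if this holds for some $k$. Words. For words over $V$: juxtaposition is concatenation, $\epsilon$ is the empty word, and $\le$ is the prefix order. Signature. $\Sigma^\lambda_1=\{@,\lambda,0\}$ with arities $2,1,1$. $\lambda$-ap-ho-term-graphs. A $\lambda$-ap-ho-term-graph over $\Sigma^\lambda_1$ is a tuple $(V,\mathit{lab},\mathit{args},r,P)$ where $(V,\mathit{lab},\mathit{args},r)$ is a term graph over $\Sigma^\lambda_1$ and $P:V\to V^*$ satisfies, for all $w,w_0,w_1$ and $k\in\{0,1\}$: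 - $P(r)=\epsilon$; - $\mathit{lab}(w)=\lambda$ and $w\rightarrowtail_0w_0$ imply $P(w_0)\le P(w)w$; - $\mathit{lab}(w)=@$ and $w\rightarrowtail_kw_k$ imply $P(w_k)\le P(w)$; - $\mathit{lab}(w)=0$ implies $P(w)\neq\epsilon$; - $\mathit{lab}(w)=0$ and $w\rightarrowtail_0w_0$ imply $\mathit{lab}(w_0)=\lambda$ and $P(w_0)w_0=P(w)$. Homomorphisms. A homomorphism from $(V_1,\mathit{lab}_1,\mathit{args}_1,r_1,P_1)$ to $(V_2,\dots,P_2)$ is a map $h:V_1\to V_2$ such that, where $\bar h$ applies $h$ letterwise to words: - $h(r_1)=r_2$; - $\mathit{lab}_2(h(v))=\mathit{lab}_1(v)$; - $\mathit{args}_2(h(v))=\bar h(\mathit{args}_1(v))$; - $P_2(h(w))=\bar h(P_1(w))$ for all $w$. An isomorphism is a bijective homomorphism. Eager-scope. Such a graph is eager-scope if, for all $w,v\in V$, $p\in V^*$ with $P(w)=pv$, there exist $n$ and $w=w_0\rightarrowtail w_1\rightarrowtail\cdots\rightarrowtail w_n$ with $\mathit{lab}(w_n)=0$, $P(w_n)=pv$, and $pv\le P(w_i)$ for $1\le i\le n-1$. *)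

theory Defs
  imports "HOL-Algebra.Complete_Lattice" "HOL-Library.Sublist"
begin

section \<open>Term graphs\<close>

text \<open>
  A signature is a type \<open>'s\<close> of symbols together with an arity function. The vertices form a set
  in a universe \<open>'v\<close>; the values of \<open>lab\<close> and \<open>args\<close> outside \<open>verts\<close> are irrelevant.
\<close>

record ('v, 's) term_graph =
  verts :: "'v set"
  lab :: "'v \<Rightarrow> 's"
  args :: "'v \<Rightarrow> 'v list"
  rt :: 'v

definition edge_nth :: "('v, 's, 'm) term_graph_scheme \<Rightarrow> nat \<Rightarrow> 'v \<Rightarrow> 'v \<Rightarrow> bool" where
  "edge_nth G k w w' \<longleftrightarrow> w \<in> verts G \<and> k < length (args G w) \<and> args G w ! k = w'"

definition edge :: "('v, 's, 'm) term_graph_scheme \<Rightarrow> 'v \<Rightarrow> 'v \<Rightarrow> bool" where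
  "edge G w w' \<longleftrightarrow> (\<exists>k. edge_nth G k w w')"

definition is_term_graph :: "('s \<Rightarrow> nat) \<Rightarrow> ('v, 's, 'm) term_graph_scheme \<Rightarrow> bool" where
  "is_term_graph ar G \<longleftrightarrow>
     (\<forall>v \<in> verts G. args G v \<in> lists (verts G) \<and> length (args G v) = ar (lab G v)) \<and>
     rt G \<in> verts G \<and>
     (\<forall>v \<in> verts G. (edge G)\<^sup>*\<^sup>* (rt G) v)"

section \<open>Lambda-ap-ho-term-graphs\<close>

text \<open>\<open>Zero\<close> is the unary symbol \<open>0\<close>, whose argument is the backlink to the binding abstraction.\<close>

datatype lsym = App | Lam | Zero

fun larity :: "lsym \<Rightarrow> nat" where
  "larity App = 2"
| "larity Lam = 1"
| "larity Zero = 1"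

record 'v lho_graph = "('v, lsym) term_graph" +
  apfx :: "'v \<Rightarrow> 'v list"

definition is_lho_graph :: "'v lho_graph \<Rightarrow> bool" where
  "is_lho_graph G \<longleftrightarrow>
     is_term_graph larity G \<and>
     (\<forall>w \<in> verts G. apfx G w \<in> lists (verts G)) \<and>
     apfx G (rt G) = [] \<and>
     (\<forall>w w0. lab G w = Lam \<and> edge_nth G 0 w w0 \<longrightarrow> prefix (apfx G w0) (apfx G w @ [w])) \<and>
     (\<forall>w wk. \<forall>k \<in> {0, 1}. lab G w = App \<and> edge_nth G k w wk \<longrightarrow> prefix (apfx G wk) (apfx G w)) \<and>
     (\<forall>w \<in> verts G. lab G w = Zero \<longrightarrow> apfx G w \<noteq> []) \<and>
     (\<forall>w w0. lab G w = Zero \<and> edge_nth G 0 w w0 \<longrightarrow>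
        lab G w0 = Lam \<and> apfx G w0 @ [w0] = apfx G w)"

definition lho_hom :: "('v \<Rightarrow> 'w) \<Rightarrow> 'v lho_graph \<Rightarrow> 'w lho_graph \<Rightarrow> bool" where
  "lho_hom h G H \<longleftrightarrow>
     h ` verts G \<subseteq> verts H \<and>
     h (rt G) = rt H \<and>
     (\<forall>v \<in> verts G. lab H (h v) = lab G v \<and>
                    args H (h v) = map h (args G v) \<and>
                    apfx H (h v) = map h (apfx G v))"

definition lho_iso :: "('v \<Rightarrow> 'w) \<Rightarrow> 'v lho_graph \<Rightarrow> 'w lho_graph \<Rightarrow> bool" where
  "lho_iso h G H \<longleftrightarrow> lho_hom h G H \<and> bij_betw h (verts G) (verts H)"

definition eager_scope :: "'v lho_graph \<Rightarrow> bool" where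
  "eager_scope G \<longleftrightarrow>
     (\<forall>w \<in> verts G. \<forall>v \<in> verts G. \<forall>p \<in> lists (verts G). apfx G w = p @ [v] \<longrightarrow>
        (\<exists>n ws. ws 0 = w \<and> (\<forall>i<n. edge G (ws i) (ws (Suc i))) \<and>
                lab G (ws n) = Zero \<and> apfx G (ws n) = p @ [v] \<and>
                (\<forall>i. 1 \<le> i \<and> i < n \<longrightarrow> prefix (p @ [v]) (apfx G (ws i)))))"

section \<open>The ordered set of homomorphic images\<close>

definition lho_iso_rel :: "('v lho_graph \<times> 'v lho_graph) set" where
  "lho_iso_rel = {(G, H). is_lho_graph G \<and> is_lho_graph H \<and> (\<exists>h. lho_iso h G H)}"

text \<open>
  All graphs have their vertices in the universe \<open>'v\<close> of the given graph. No isomorphism class of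
  images is lost by this: see the lemma \<open>image_in_universe\<close> below.
\<close>

definition image_classes :: "'v lho_graph \<Rightarrow> 'v lho_graph set set" where
  "image_classes G = {G'. is_lho_graph G' \<and> (\<exists>h. lho_hom h G G')} // lho_iso_rel"

text \<open>
  On isomorphism classes, the existence of a homomorphism does not depend on the chosen
  representatives (see \<open>class_le_iff\<close>).
\<close>

definition class_le :: "'v lho_graph set \<Rightarrow> 'v lho_graph set \<Rightarrow> bool" where
  "class_le C D \<longleftrightarrow> (\<exists>G1 \<in> C. \<exists>G2 \<in> D. \<exists>h. lho_hom h G1 G2)"

definition image_order :: "'v lho_graph \<Rightarrow> 'v lho_graph set gorder" where
  "image_order G = \<lparr>carrier = image_classes G, eq = (=), le = class_le\<rparr>"

section \<open>Well-definedness\<close>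

lemma lho_hom_comp:
  assumes "lho_hom f G H" "lho_hom g H K"
  shows "lho_hom (g \<circ> f) G K"
  using assms unfolding lho_hom_def by (simp add: image_subset_iff)

lemma lho_iso_inv:
  assumes G: "is_lho_graph G" and iso: "lho_iso h G H"
  shows "lho_iso (inv_into (verts G) h) H G"
proof -
  let ?g = "inv_into (verts G) h"
  have hom: "lho_hom h G H" and bij: "bij_betw h (verts G) (verts H)"
    using iso by (auto simp: lho_iso_def)
  have inv: "?g (h v) = v" if "v \<in> verts G" for v
    using bij that by (simp add: bij_betw_def)
  have minv: "map ?g (map h xs) = xs" if "xs \<in> lists (verts G)" for xs
    using that by (induction xs) (auto simp: inv)
  have li: "args G v \<in> lists (verts G)" "apfx G v \<in> lists (verts G)" if "v \<in> verts G" for v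
    using G that by (auto simp: is_lho_graph_def is_term_graph_def)
  have rt: "rt G \<in> verts G"
    using G by (auto simp: is_lho_graph_def is_term_graph_def)
  have im: "verts H = h ` verts G"
    using bij by (simp add: bij_betw_def)
  have "lho_hom ?g H G"
    unfolding lho_hom_def
  proof (intro conjI ballI)
    show "?g ` verts H \<subseteq> verts G"
      by (auto simp: im inv)
    show "?g (rt H) = rt G"
      using hom inv[OF rt] by (simp add: lho_hom_def)
  next
    fix u assume "u \<in> verts H"
    then obtain v where v: "v \<in> verts G" "u = h v"
      by (auto simp: im)
    show "lab G (?g u) = lab H u"
      using hom v by (simp add: lho_hom_def inv)
    show "args G (?g u) = map ?g (args H u)" "apfx G (?g u) = map ?g (apfx H u)"
      using hom v minv[OF li(1)[OF v(1)]] minv[OF li(2)[OF v(1)]]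
      by (simp_all add: lho_hom_def inv del: map_map)
  qed
  then show ?thesis
    using bij by (simp add: lho_iso_def bij_betw_inv_into)
qed

lemma equiv_lho_iso_rel: "equiv {G :: 'v lho_graph. is_lho_graph G} lho_iso_rel"
proof (rule equivI)
  show "refl_on {G :: 'v lho_graph. is_lho_graph G} lho_iso_rel"
  proof (rule refl_onI)
    fix G :: "'v lho_graph" assume "G \<in> {G. is_lho_graph G}"
    moreover have "lho_iso id G G"
      by (auto simp: lho_iso_def lho_hom_def)
    ultimately show "(G, G) \<in> lho_iso_rel"
      by (auto simp: lho_iso_rel_def)
  qed
  show "sym (lho_iso_rel :: ('v lho_graph \<times> _) set)"
  proof (rule symI)
    fix G H :: "'v lho_graph" assume "(G, H) \<in> lho_iso_rel"
    then obtain h where h: "is_lho_graph G" "is_lho_graph H" "lho_iso h G H"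
      by (auto simp: lho_iso_rel_def)
    then show "(H, G) \<in> lho_iso_rel"
      using lho_iso_inv[OF h(1,3)] by (auto simp: lho_iso_rel_def)
  qed
  show "trans (lho_iso_rel :: ('v lho_graph \<times> _) set)"
  proof (rule transI)
    fix G H K :: "'v lho_graph"
    assume "(G, H) \<in> lho_iso_rel" "(H, K) \<in> lho_iso_rel"
    then obtain f g where gr: "is_lho_graph G" "is_lho_graph K"
      and "lho_iso f G H" "lho_iso g H K"
      by (auto simp: lho_iso_rel_def)
    then have "lho_iso (g \<circ> f) G K"
      unfolding lho_iso_def by (meson lho_hom_comp bij_betw_trans)
    then show "(G, K) \<in> lho_iso_rel"
      using gr by (auto simp: lho_iso_rel_def)
  qed
  show "(lho_iso_rel :: ('v lho_graph \<times> _) set) \<subseteq> {G. is_lho_graph G} \<times> {G. is_lho_graph G}"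
    by (auto simp: lho_iso_rel_def)
qed

lemma class_le_iff:
  fixes G1 G2 :: "'v lho_graph"
  assumes "is_lho_graph G1" "is_lho_graph G2"
  shows "class_le (lho_iso_rel `` {G1}) (lho_iso_rel `` {G2}) \<longleftrightarrow> (\<exists>h. lho_hom h G1 G2)"
proof
  assume "class_le (lho_iso_rel `` {G1}) (lho_iso_rel `` {G2})"
  then obtain H1 H2 :: "'v lho_graph" and h f g where h: "lho_hom h H1 H2"
    and f: "lho_iso f G1 H1" and g: "lho_iso g G2 H2"
    unfolding class_le_def lho_iso_rel_def by blast
  have "lho_hom (inv_into (verts G2) g) H2 G2"
    using lho_iso_inv[OF assms(2) g] by (simp add: lho_iso_def)
  then show "\<exists>h. lho_hom h G1 G2"
    using lho_hom_comp[OF lho_hom_comp[OF _ h]] f unfolding lho_iso_def by blast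
next
  assume "\<exists>h. lho_hom h G1 G2"
  moreover have "G1 \<in> lho_iso_rel `` {G1}" "G2 \<in> lho_iso_rel `` {G2}"
    by (rule equiv_class_self[OF equiv_lho_iso_rel], simp add: assms)+
  ultimately show "class_le (lho_iso_rel `` {G1}) (lho_iso_rel `` {G2})"
    unfolding class_le_def by (meson bexI)
qed

lemma lho_hom_surj:
  assumes G: "is_lho_graph G" and H: "is_lho_graph H" and h: "lho_hom h G H"
  shows "h ` verts G = verts H"
proof
  have rt: "rt G \<in> verts G" and argsG: "\<And>u. u \<in> verts G \<Longrightarrow> set (args G u) \<subseteq> verts G"
    using G unfolding is_lho_graph_def is_term_graph_def in_lists_conv_set by blast+
  show "h ` verts G \<subseteq> verts H"
    using h by (simp add: lho_hom_def)
  show "verts H \<subseteq> h ` verts G"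
  proof
    fix v assume "v \<in> verts H"
    then have "(edge H)\<^sup>*\<^sup>* (rt H) v"
      using H unfolding is_lho_graph_def is_term_graph_def by blast
    then show "v \<in> h ` verts G"
    proof induction
      case base
      show ?case
        using h imageI[OF rt, of h] by (simp add: lho_hom_def)
    next
      case (step y z)
      then obtain u where u: "u \<in> verts G" "y = h u" by auto
      have "args H y = map h (args G u)"
        using h u by (simp add: lho_hom_def)
      moreover have "z \<in> set (args H y)"
        using step.hyps(2) unfolding edge_def edge_nth_def by (metis nth_mem)
      ultimately show ?case
        using argsG[OF u(1)] by auto
    qed
  qed
qed

lemma is_lho_graph_transport:
  assumes H: "is_lho_graph H" and inj: "inj_on g (verts H)"
  shows "\<exists>K. is_lho_graph K \<and> lho_iso g H K"
proof -
  define i where "i = inv_into (verts H) g"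
  define K where "K = \<lparr>verts = g ` verts H, lab = lab H \<circ> i, args = map g \<circ> args H \<circ> i,
    rt = g (rt H), apfx = map g \<circ> apfx H \<circ> i\<rparr>"
  have i: "i (g v) = v" if "v \<in> verts H" for v
    using inj that by (simp add: i_def)
  have sel: "verts K = g ` verts H" "rt K = g (rt H)"
    by (simp_all add: K_def)
  have K: "lab K (g v) = lab H v" "args K (g v) = map g (args H v)"
    "apfx K (g v) = map g (apfx H v)" if "v \<in> verts H" for v
    using i[OF that] by (simp_all add: K_def)
  have li: "args H v \<in> lists (verts H)" "apfx H v \<in> lists (verts H)"
    "length (args H v) = larity (lab H v)" if "v \<in> verts H" for v
    using H that by (auto simp: is_lho_graph_def is_term_graph_def)
  have rt: "rt H \<in> verts H" and apr: "apfx H (rt H) = []"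
    using H by (auto simp: is_lho_graph_def is_term_graph_def)
  have eE: "\<exists>u v. u \<in> verts H \<and> v \<in> verts H \<and> w = g u \<and> w' = g v \<and> edge_nth H k u v"
    if e: "edge_nth K k w w'" for k w w'
  proof -
    from e obtain u where u: "u \<in> verts H" "w = g u"
      by (auto simp: edge_nth_def sel)
    then have k: "k < length (args H u)" "w' = g (args H u ! k)"
      using e by (auto simp: edge_nth_def K)
    then have "args H u ! k \<in> verts H"
      using li(1)[OF u(1)] by (auto simp: in_lists_conv_set)
    then show ?thesis
      using u k by (auto simp: edge_nth_def)
  qed
  have eI: "edge K (g u) (g v)" if "edge H u v" for u v
    using that by (auto simp: edge_def edge_nth_def sel K)
  have iso: "lho_iso g H K"
    using inj by (auto simp: lho_iso_def lho_hom_def bij_betw_def sel K)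
  have reach: "(edge K)\<^sup>*\<^sup>* (g (rt H)) (g v)" if "v \<in> verts H" for v
  proof -
    have "(edge H)\<^sup>*\<^sup>* (rt H) v"
      using H that by (auto simp: is_lho_graph_def is_term_graph_def)
    then show ?thesis
      by induction (auto intro: rtranclp.rtrancl_into_rtrancl eI)
  qed
  have tg: "is_term_graph larity K"
    unfolding is_term_graph_def sel
  proof (intro conjI ballI)
    fix w assume "w \<in> g ` verts H"
    then obtain v where v: "v \<in> verts H" "w = g v" by blast
    show "args K w \<in> lists (g ` verts H)"
      using li(1)[OF v(1)] v by (auto simp: K in_lists_conv_set)
    show "length (args K w) = larity (lab K w)"
      using li(3)[OF v(1)] v by (simp add: K)
    show "(edge K)\<^sup>*\<^sup>* (g (rt H)) w"
      using reach v by simp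
  next
    show "g (rt H) \<in> g ` verts H" using rt by simp
  qed
  have "is_lho_graph K"
    unfolding is_lho_graph_def
  proof (intro conjI allI ballI impI)
    show "is_term_graph larity K" by (rule tg)
    show "apfx K w \<in> lists (verts K)" if "w \<in> verts K" for w
      using that li(2) by (auto simp: sel K in_lists_conv_set)
    show "apfx K (rt K) = []"
      using rt apr by (simp add: sel K)
    show "prefix (apfx K w0) (apfx K w @ [w])" if e: "lab K w = Lam \<and> edge_nth K 0 w w0" for w w0
    proof -
      obtain u v where uv: "u \<in> verts H" "v \<in> verts H" "w = g u" "w0 = g v" "edge_nth H 0 u v"
        using e eE by blast
      then have "prefix (apfx H v) (apfx H u @ [u])"
        using H e by (auto simp: is_lho_graph_def K)
      then have "prefix (map g (apfx H v)) (map g (apfx H u @ [u]))"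
        by (rule map_mono_prefix)
      then show ?thesis using uv by (simp add: K)
    qed
    show "prefix (apfx K wk) (apfx K w)"
      if kk: "k \<in> {0, 1}" and e: "lab K w = App \<and> edge_nth K k w wk" for w wk k
    proof -
      obtain u v where uv: "u \<in> verts H" "v \<in> verts H" "w = g u" "wk = g v" "edge_nth H k u v"
        using e eE by blast
      then have "prefix (apfx H v) (apfx H u)"
        using H e kk by (auto simp: is_lho_graph_def K)
      then show ?thesis using uv by (simp add: K map_mono_prefix)
    qed
    show "apfx K w \<noteq> []" if "w \<in> verts K" "lab K w = Zero" for w
      using that H by (auto simp: is_lho_graph_def sel K)
    show "lab K w0 = Lam" "apfx K w0 @ [w0] = apfx K w"
      if e: "lab K w = Zero \<and> edge_nth K 0 w w0" for w w0
    proof -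
      obtain u v where uv: "u \<in> verts H" "v \<in> verts H" "w = g u" "w0 = g v" "edge_nth H 0 u v"
        using e eE by blast
      then have *: "lab H v = Lam" "apfx H v @ [v] = apfx H u"
        using H e by (auto simp: is_lho_graph_def K)
      show "lab K w0 = Lam" using uv * by (simp add: K)
      show "apfx K w0 @ [w0] = apfx K w"
        using uv arg_cong[OF *(2), of "map g"] by (simp add: K)
    qed
  qed
  then show ?thesis using iso by blast
qed

text \<open>Every homomorphic image, over any type of vertices, has an isomorphic copy in \<open>'v\<close>.\<close>

lemma image_in_universe:
  fixes G :: "'v lho_graph" and H :: "'w lho_graph"
  assumes "is_lho_graph G" "is_lho_graph H" "lho_hom h G H"
  shows "\<exists>K :: 'v lho_graph. is_lho_graph K \<and> (\<exists>g. lho_iso g H K)"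
proof -
  have "inj_on (inv_into (verts G) h) (verts H)"
    using lho_hom_surj[OF assms] by (metis inj_on_inv_into order_refl)
  then show ?thesis
    using is_lho_graph_transport[OF assms(2)] by blast
qed

end

theory Submission
  imports Defs
begin

text \<open>
  Homomorphic images of \<open>G\<close> are classified by their kernels, the equivalence relations on the vertices
  of \<open>G\<close> that respect labels, arguments and abstraction prefixes: homomorphisms out of a term graph
  are unique and surjective, so a homomorphism from one image to another exists iff the kernel
  of the first is contained in that of the second. Such relations are closed under the transitive closure of arbitrary
  unions, because relatedness of words is letterwise and hence composes along chains.
\<close>

section \<open>Congruences and kernels\<close>

lemma map_eq_iff_list_all2: "map f xs = map g ys \<longleftrightarrow> list_all2 (\<lambda>x y. f x = g y) xs ys"
  by (auto simp: list_eq_iff_nth_eq list_all2_conv_all_nth)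

text \<open>These are meant to be exactly the kernels of homomorphisms out of \<open>G\<close>.
  \<open>list_all2\<close> relates words letterwise and forces equal lengths, so that arguments and
  prefixes descend to equivalence classes.\<close>

definition lho_cong :: "'v lho_graph \<Rightarrow> 'v rel \<Rightarrow> bool" where
  "lho_cong G R \<longleftrightarrow> equiv (verts G) R \<and>
     (\<forall>(u, v) \<in> R. lab G u = lab G v \<and>
        list_all2 (\<lambda>x y. (x, y) \<in> R) (args G u) (args G v) \<and>
        list_all2 (\<lambda>x y. (x, y) \<in> R) (apfx G u) (apfx G v))"

text \<open>The restriction to \<open>A\<close> discards the values of the total function
  \<open>h\<close> outside the vertices, which \<open>lho_hom\<close> leaves arbitrary.\<close>

definition kernel_on :: "'a set \<Rightarrow> ('a \<Rightarrow> 'b) \<Rightarrow> 'a rel" where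
  "kernel_on A h = {(u, v). u \<in> A \<and> v \<in> A \<and> h u = h v}"

lemma lho_graph_lists:
  assumes "is_lho_graph G" "v \<in> verts G"
  shows "set (args G v) \<subseteq> verts G" "set (apfx G v) \<subseteq> verts G"
  using assms unfolding is_lho_graph_def is_term_graph_def in_lists_conv_set by blast+

lemma rt_in_verts: "is_lho_graph G \<Longrightarrow> rt G \<in> verts G"
  by (simp add: is_lho_graph_def is_term_graph_def)

text \<open>If \<open>h u = h v\<close>, then the label, the argument word and the prefix of this
  common image are determined by \<open>u\<close> and equally by \<open>v\<close>. Equality of words
  mapped by \<open>h\<close> is letterwise membership in the kernel.\<close>

lemma lho_cong_kernel:
  assumes G: "is_lho_graph G" and h: "lho_hom h G H"
  shows "lho_cong G (kernel_on (verts G) h)"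
  unfolding lho_cong_def
proof (intro conjI)
  show "equiv (verts G) (kernel_on (verts G) h)"
    by (auto simp: kernel_on_def intro!: equivI refl_onI symI transI)
  have "lab G u = lab G v \<and>
      list_all2 (\<lambda>x y. (x, y) \<in> kernel_on (verts G) h) (args G u) (args G v) \<and>
      list_all2 (\<lambda>x y. (x, y) \<in> kernel_on (verts G) h) (apfx G u) (apfx G v)"
    if "(u, v) \<in> kernel_on (verts G) h" for u v
  proof -
    have uv: "u \<in> verts G" "v \<in> verts G" "h u = h v"
      using that by (auto simp: kernel_on_def)
    have "lab G u = lab G v" "map h (args G u) = map h (args G v)"
      "map h (apfx G u) = map h (apfx G v)"
      using h uv unfolding lho_hom_def by metis+
    moreover have "list_all2 (\<lambda>x y. (x, y) \<in> kernel_on (verts G) h) xs ys"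
      if "map h xs = map h ys" "set xs \<subseteq> verts G" "set ys \<subseteq> verts G" for xs ys
      using that unfolding map_eq_iff_list_all2
      by (auto simp: kernel_on_def list_all2_conv_all_nth subset_iff)
    ultimately show ?thesis
      using lho_graph_lists[OF G uv(1)] lho_graph_lists[OF G uv(2)] by blast
  qed
  then show "\<forall>(u, v) \<in> kernel_on (verts G) h. lab G u = lab G v \<and>
      list_all2 (\<lambda>x y. (x, y) \<in> kernel_on (verts G) h) (args G u) (args G v) \<and>
      list_all2 (\<lambda>x y. (x, y) \<in> kernel_on (verts G) h) (apfx G u) (apfx G v)"
    by blast
qed

section \<open>Homomorphisms compared through their kernels\<close>

text \<open>Two homomorphisms agree at the root, and agreement at a vertex passes to its successors
  because the mapped argument words coincide. Every vertex is reachable from the root.\<close>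

lemma lho_hom_unique:
  assumes G: "is_lho_graph G" and f: "lho_hom f G H" and g: "lho_hom g G H"
    and v: "v \<in> verts G"
  shows "f v = g v"
proof -
  have "(edge G)\<^sup>*\<^sup>* (rt G) v"
    using G v by (simp add: is_lho_graph_def is_term_graph_def)
  then show ?thesis
  proof induction
    case base
    show ?case using f g by (simp add: lho_hom_def)
  next
    case (step y z)
    then obtain k where y: "y \<in> verts G" and k: "k < length (args G y)" "args G y ! k = z"
      by (auto simp: edge_def edge_nth_def)
    have "map f (args G y) = map g (args G y)"
      using f g y step.IH unfolding lho_hom_def by metis
    then show ?case
      using k by (metis nth_map)
  qed
qed

text \<open>Since \<open>h1\<close> is onto \<open>H1\<close>, the inclusion of kernels makes the
  assignment of \<open>h2 v\<close> to \<open>h1 v\<close> a well-defined map. It preserves the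
  structure because the data at \<open>h1 v\<close> and at \<open>h2 v\<close> are both images of
  the data at \<open>v\<close>.\<close>

lemma lho_hom_factor:
  assumes G: "is_lho_graph G" and H1: "is_lho_graph H1" and h1: "lho_hom h1 G H1"
    and h2: "lho_hom h2 G H2" and ker: "kernel_on (verts G) h1 \<subseteq> kernel_on (verts G) h2"
  obtains f where "lho_hom f H1 H2" "\<And>v. v \<in> verts G \<Longrightarrow> f (h1 v) = h2 v"
proof -
  \<comment> \<open>An arbitrary preimage under \<open>h1\<close> is chosen; the inclusion of
    kernels makes its \<open>h2\<close>-value independent of the choice.\<close>
  define f where "f = h2 \<circ> inv_into (verts G) h1"
  have f: "f (h1 v) = h2 v" if v: "v \<in> verts G" for v
  proof -
    have "(inv_into (verts G) h1 (h1 v), v) \<in> kernel_on (verts G) h1"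
      using v by (simp add: kernel_on_def inv_into_into f_inv_into_f)
    then show ?thesis
      using ker by (auto simp: f_def kernel_on_def)
  qed
  then have fmap: "map f (map h1 xs) = map h2 xs" if "set xs \<subseteq> verts G" for xs
    using that by auto
  have im: "verts H1 = h1 ` verts G"
    using lho_hom_surj[OF G H1 h1] by simp
  have "lho_hom f H1 H2"
    unfolding lho_hom_def
  proof (intro conjI ballI)
    show "f ` verts H1 \<subseteq> verts H2"
      using h2 f by (auto simp: im lho_hom_def)
    show "f (rt H1) = rt H2"
      using h1 h2 f[OF rt_in_verts[OF G]] by (simp add: lho_hom_def)
  next
    fix w assume "w \<in> verts H1"
    then obtain v where v: "v \<in> verts G" "w = h1 v"
      by (auto simp: im)
    show "lab H2 (f w) = lab H1 w"
      using h1 h2 v by (simp add: lho_hom_def f)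
    show "args H2 (f w) = map f (args H1 w)" "apfx H2 (f w) = map f (apfx H1 w)"
      using h1 h2 v fmap[OF lho_graph_lists(1)[OF G v(1)]] fmap[OF lho_graph_lists(2)[OF G v(1)]]
      by (simp_all add: lho_hom_def f del: map_map)
  qed
  then show ?thesis using that f by blast
qed

text \<open>By uniqueness, any \<open>f\<close> composed with \<open>h1\<close> is \<open>h2\<close>
  on the vertices of \<open>G\<close>, so \<open>h2\<close> identifies whatever \<open>h1\<close>
  does. The converse is the factorization.\<close>

lemma ex_lho_hom_iff_kernel_subset:
  assumes G: "is_lho_graph G" and H1: "is_lho_graph H1"
    and h1: "lho_hom h1 G H1" and h2: "lho_hom h2 G H2"
  shows "(\<exists>f. lho_hom f H1 H2) \<longleftrightarrow> kernel_on (verts G) h1 \<subseteq> kernel_on (verts G) h2"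
proof
  assume "\<exists>f. lho_hom f H1 H2"
  then obtain f where "lho_hom f H1 H2" by blast
  then have "h2 v = f (h1 v)" if "v \<in> verts G" for v
    using lho_hom_unique[OF G h2 lho_hom_comp[OF h1] that] by simp
  then show "kernel_on (verts G) h1 \<subseteq> kernel_on (verts G) h2"
    by (auto simp: kernel_on_def)
qed (meson G H1 h1 h2 lho_hom_factor)

text \<open>The factor map is onto like every homomorphism of these graphs, and the reverse
  inclusion of kernels makes it injective.\<close>

lemma lho_iso_if_kernel_eq:
  assumes G: "is_lho_graph G" and H1: "is_lho_graph H1" and H2: "is_lho_graph H2"
    and h1: "lho_hom h1 G H1" and h2: "lho_hom h2 G H2"
    and ker: "kernel_on (verts G) h1 = kernel_on (verts G) h2"
  shows "\<exists>f. lho_iso f H1 H2"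
proof -
  obtain f where f: "lho_hom f H1 H2" "\<And>v. v \<in> verts G \<Longrightarrow> f (h1 v) = h2 v"
    using lho_hom_factor[OF G H1 h1 h2] ker by blast
  have "h1 u = h1 v" if "u \<in> verts G" "v \<in> verts G" "h2 u = h2 v" for u v
  proof -
    have "(u, v) \<in> kernel_on (verts G) h1"
      unfolding ker using that by (simp add: kernel_on_def)
    then show ?thesis by (simp add: kernel_on_def)
  qed
  then have "inj_on f (verts H1)"
    unfolding lho_hom_surj[OF G H1 h1, symmetric] by (intro inj_onI) (metis f(2) imageE)
  then show ?thesis
    using f(1) lho_hom_surj[OF H1 H2 f(1)] by (auto simp: lho_iso_def bij_betw_def)
qed

section \<open>Quotients by congruences\<close>

text \<open>The quotient lives on representatives, so that it stays in the universe of \<open>G\<close>.\<close>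

definition representative :: "'a rel \<Rightarrow> 'a \<Rightarrow> 'a" where
  "representative R v = (SOME u. (v, u) \<in> R)"

definition quotient_graph :: "'v lho_graph \<Rightarrow> 'v rel \<Rightarrow> 'v lho_graph" where
  "quotient_graph G R = \<lparr>verts = representative R ` verts G, lab = lab G,
     args = map (representative R) \<circ> args G, rt = representative R (rt G),
     apfx = map (representative R) \<circ> apfx G\<rparr>"

lemma representative_related: "equiv A R \<Longrightarrow> v \<in> A \<Longrightarrow> (v, representative R v) \<in> R"
  unfolding representative_def by (rule someI[of _ v]) (auto simp: equiv_def refl_on_def)

lemma representative_eq: "equiv A R \<Longrightarrow> (u, v) \<in> R \<Longrightarrow> representative R u = representative R v"
  unfolding representative_def by (metis equivE symE transE)

text \<open>This recovers a congruence from its quotient map, so that distinct congruences give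
  quotient maps with distinct kernels.\<close>

lemma kernel_representative:
  assumes "equiv A R" shows "kernel_on A (representative R) = R"
proof -
  have "(u, v) \<in> R" if "u \<in> A" "v \<in> A" "representative R u = representative R v" for u v
    using representative_related[OF assms that(1)] representative_related[OF assms that(2)] that(3)
      assms by (metis equivE symE transE)
  moreover have "u \<in> A \<and> v \<in> A" if "(u, v) \<in> R" for u v
    using that assms by (auto simp: equiv_def)
  ultimately show ?thesis
    unfolding kernel_on_def by (blast dest: representative_eq[OF assms])
qed

text \<open>All conditions on edges and prefixes are preserved by a letterwise map of words, so they
  pass from \<open>G\<close> to the quotient once edges can be lifted.\<close>

lemma quotient_graph:
  assumes G: "is_lho_graph G" and R: "lho_cong G R"
  shows "is_lho_graph (quotient_graph G R)"
    and "lho_hom (representative R) G (quotient_graph G R)"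
proof -
  define q where "q = representative R"
  define Q where "Q = quotient_graph G R"
  have eq: "equiv (verts G) R"
    using R by (simp add: lho_cong_def)
  have q: "(v, q v) \<in> R" if "v \<in> verts G" for v
    using representative_related[OF eq that] by (simp add: q_def)
  have qmap: "map q xs = map q ys" if "list_all2 (\<lambda>x y. (x, y) \<in> R) xs ys" for xs ys
    unfolding map_eq_iff_list_all2
    using that by (rule list_all2_mono) (simp add: q_def representative_eq[OF eq])
  \<comment> \<open>The quotient reads its data at the representative \<open>q v\<close> itself. As
    \<open>v\<close> and \<open>q v\<close> are related, labels agree and the words agree after
    applying \<open>q\<close>.\<close>
  have Q: "lab Q (q v) = lab G v" "args Q (q v) = map q (args G v)"
    "apfx Q (q v) = map q (apfx G v)" if "v \<in> verts G" for v
    using R q[OF that] qmap by (fastforce simp: Q_def quotient_graph_def q_def lho_cong_def)+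
  have sel: "verts Q = q ` verts G" "rt Q = q (rt G)"
    by (simp_all add: Q_def quotient_graph_def q_def)
  have hom: "lho_hom q G Q"
    by (auto simp: lho_hom_def sel Q)
  \<comment> \<open>Every edge of the quotient lifts to an edge of \<open>G\<close> at the same
    argument position, where the conditions are known.\<close>
  have edgeE: "\<exists>u v. u \<in> verts G \<and> v \<in> verts G \<and> w = q u \<and> w' = q v \<and> edge_nth G k u v"
    if e: "edge_nth Q k w w'" for k w w'
  proof -
    from e obtain u where u: "u \<in> verts G" "w = q u"
      by (auto simp: edge_nth_def sel)
    then have k: "k < length (args G u)" "w' = q (args G u ! k)"
      using e by (auto simp: edge_nth_def Q)
    then have "args G u ! k \<in> verts G"
      using lho_graph_lists(1)[OF G u(1)] by auto
    then show ?thesis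
      using u k by (auto simp: edge_nth_def)
  qed
  have edgeI: "edge Q (q u) (q v)" if "edge G u v" for u v
    using that by (auto simp: edge_def edge_nth_def sel Q)
  have reach: "(edge Q)\<^sup>*\<^sup>* (q (rt G)) (q v)" if "v \<in> verts G" for v
  proof -
    have "(edge G)\<^sup>*\<^sup>* (rt G) v"
      using G that by (simp add: is_lho_graph_def is_term_graph_def)
    then show ?thesis
      by induction (auto intro: rtranclp.rtrancl_into_rtrancl edgeI)
  qed
  have tg: "is_term_graph larity Q"
    unfolding is_term_graph_def
  proof (intro conjI ballI)
    show "rt Q \<in> verts Q"
      using rt_in_verts[OF G] by (simp add: sel)
  next
    fix w assume "w \<in> verts Q"
    then obtain v where v: "v \<in> verts G" "w = q v" by (auto simp: sel)
    show "args Q w \<in> lists (verts Q)"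
      using lho_graph_lists(1)[OF G v(1)] v by (auto simp: Q sel subset_iff)
    show "length (args Q w) = larity (lab Q w)"
      using G v by (simp add: Q is_lho_graph_def is_term_graph_def)
    show "(edge Q)\<^sup>*\<^sup>* (rt Q) w"
      using reach v by (simp add: sel)
  qed
  have "is_lho_graph Q"
    unfolding is_lho_graph_def
  proof (intro conjI allI ballI impI)
    show "is_term_graph larity Q" by (rule tg)
    show "apfx Q w \<in> lists (verts Q)" if w: "w \<in> verts Q" for w
    proof -
      obtain v where v: "v \<in> verts G" "w = q v" using w by (auto simp: sel)
      then show ?thesis
        using lho_graph_lists(2)[OF G v(1)] by (auto simp: Q sel subset_iff)
    qed
    show "apfx Q (rt Q) = []"
      using G rt_in_verts[OF G] by (simp add: sel Q is_lho_graph_def)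
    show "prefix (apfx Q w0) (apfx Q w @ [w])" if e: "lab Q w = Lam \<and> edge_nth Q 0 w w0" for w w0
    proof -
      obtain u v where uv: "u \<in> verts G" "v \<in> verts G" "w = q u" "w0 = q v" "edge_nth G 0 u v"
        using e edgeE by blast
      then have "prefix (apfx G v) (apfx G u @ [u])"
        using G e by (auto simp: is_lho_graph_def Q)
      then have "prefix (map q (apfx G v)) (map q (apfx G u @ [u]))"
        by (rule map_mono_prefix)
      then show ?thesis using uv by (simp add: Q)
    qed
    show "prefix (apfx Q wk) (apfx Q w)"
      if k: "k \<in> {0, 1}" and e: "lab Q w = App \<and> edge_nth Q k w wk" for w wk k
    proof -
      obtain u v where uv: "u \<in> verts G" "v \<in> verts G" "w = q u" "wk = q v" "edge_nth G k u v"
        using e edgeE by blast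
      then have "prefix (apfx G v) (apfx G u)"
        using G e k by (auto simp: is_lho_graph_def Q)
      then show ?thesis using uv by (simp add: Q map_mono_prefix)
    qed
    show "apfx Q w \<noteq> []" if "w \<in> verts Q" "lab Q w = Zero" for w
      using that G by (auto simp: is_lho_graph_def sel Q)
    show "lab Q w0 = Lam" "apfx Q w0 @ [w0] = apfx Q w"
      if e: "lab Q w = Zero \<and> edge_nth Q 0 w w0" for w w0
    proof -
      obtain u v where uv: "u \<in> verts G" "v \<in> verts G" "w = q u" "w0 = q v" "edge_nth G 0 u v"
        using e edgeE by blast
      then have bind: "lab G v = Lam" "apfx G v @ [v] = apfx G u"
        using G e by (auto simp: is_lho_graph_def Q)
      show "lab Q w0 = Lam" using uv bind by (simp add: Q)
      show "apfx Q w0 @ [w0] = apfx Q w"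
        using uv arg_cong[OF bind(2), of "map q"] by (simp add: Q)
    qed
  qed
  with hom show "is_lho_graph (quotient_graph G R)"
    "lho_hom (representative R) G (quotient_graph G R)"
    by (simp_all add: Q_def q_def)
qed

section \<open>Isomorphism classes of images as congruences\<close>

definition quotient_class :: "'v lho_graph \<Rightarrow> 'v rel \<Rightarrow> 'v lho_graph set" where
  "quotient_class G R = lho_iso_rel `` {quotient_graph G R}"

text \<open>The kernels of the two quotient maps are \<open>R\<close> and \<open>S\<close>. Hence
  \<open>quotient_class G\<close> embeds the congruences, ordered by inclusion, into the isomorphism
  classes.\<close>

lemma class_le_quotient_class:
  assumes G: "is_lho_graph G" and R: "lho_cong G R" and S: "lho_cong G S"
  shows "class_le (quotient_class G R) (quotient_class G S) \<longleftrightarrow> R \<subseteq> S"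
proof -
  have "equiv (verts G) R" "equiv (verts G) S"
    using R S by (simp_all add: lho_cong_def)
  then show ?thesis
    unfolding quotient_class_def
      class_le_iff[OF quotient_graph(1)[OF G R] quotient_graph(1)[OF G S]]
      ex_lho_hom_iff_kernel_subset[OF G quotient_graph(1)[OF G R] quotient_graph(2)[OF G R]
        quotient_graph(2)[OF G S]]
    by (simp add: kernel_representative)
qed

text \<open>An image of \<open>G\<close> under \<open>h\<close> and the quotient of \<open>G\<close>
  by the kernel of \<open>h\<close> are targets of maps with the same kernel, hence
  isomorphic.\<close>

lemma image_classes_eq:
  assumes G: "is_lho_graph G"
  shows "image_classes G = quotient_class G ` {R. lho_cong G R}"
proof (intro equalityI subsetI)
  fix C assume "C \<in> image_classes G"
  then obtain H h where H: "is_lho_graph H" and h: "lho_hom h G H" and C: "C = lho_iso_rel `` {H}"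
    by (auto simp: image_classes_def quotient_def)
  define R where "R = kernel_on (verts G) h"
  have R: "lho_cong G R"
    unfolding R_def by (rule lho_cong_kernel[OF G h])
  then have "kernel_on (verts G) h = kernel_on (verts G) (representative R)"
    using kernel_representative[of "verts G" R] by (simp add: R_def lho_cong_def)
  then have "(H, quotient_graph G R) \<in> lho_iso_rel"
    using lho_iso_if_kernel_eq[OF G H quotient_graph(1)[OF G R] h quotient_graph(2)[OF G R]]
      H quotient_graph(1)[OF G R]
    by (simp add: lho_iso_rel_def)
  then have "C = quotient_class G R"
    unfolding C quotient_class_def by (rule equiv_class_eq[OF equiv_lho_iso_rel])
  then show "C \<in> quotient_class G ` {R. lho_cong G R}"
    using R by blast
next
  fix C assume "C \<in> quotient_class G ` {R. lho_cong G R}"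
  then obtain R where "lho_cong G R" "C = quotient_class G R" by blast
  then show "C \<in> image_classes G"
    using quotient_graph[OF G] unfolding image_classes_def quotient_def quotient_class_def by blast
qed

section \<open>Suprema of congruences\<close>

text \<open>The diagonal supplies reflexivity even for the empty family, whose supremum is the
  identity on the vertices.\<close>

definition cong_Sup :: "'v lho_graph \<Rightarrow> 'v rel set \<Rightarrow> 'v rel" where
  "cong_Sup G \<R> = (Id_on (verts G) \<union> \<Union>\<R>)\<^sup>+"

lemma cong_Sup_upper: "R \<in> \<R> \<Longrightarrow> R \<subseteq> cong_Sup G \<R>"
  by (auto simp: cong_Sup_def)

lemma cong_Sup_least:
  assumes T: "lho_cong G T" and ub: "\<And>R. R \<in> \<R> \<Longrightarrow> R \<subseteq> T"
  shows "cong_Sup G \<R> \<subseteq> T"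
proof -
  have eq: "equiv (verts G) T"
    using T by (simp add: lho_cong_def)
  then have "Id_on (verts G) \<union> \<Union>\<R> \<subseteq> T"
    using ub by (auto simp: equiv_def refl_on_def)
  then have "cong_Sup G \<R> \<subseteq> T\<^sup>+"
    unfolding cong_Sup_def by (rule trancl_mono_subset)
  also have "T\<^sup>+ = T"
    using eq by (simp add: equiv_def)
  finally show ?thesis .
qed

text \<open>A single link of a chain respects the structure because it lies on the diagonal or in
  some congruence; longer chains follow by transitivity of letterwise relatedness.\<close>

lemma lho_cong_Sup:
  assumes G: "is_lho_graph G" and \<R>: "\<And>R. R \<in> \<R> \<Longrightarrow> lho_cong G R"
  shows "lho_cong G (cong_Sup G \<R>)"
proof -
  define U where "U = Id_on (verts G) \<union> \<Union>\<R>"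
  have equivR: "equiv (verts G) R" if "R \<in> \<R>" for R
    using \<R>[OF that] by (simp add: lho_cong_def)
  have "U \<subseteq> verts G \<times> verts G"
    using equivR by (auto simp: U_def equiv_def)
  then have "U\<^sup>+ \<subseteq> verts G \<times> verts G"
    by (rule trancl_subset_Sigma)
  moreover have "sym U"
    using equivR by (fastforce simp: U_def equiv_def sym_def)
  moreover have "refl_on (verts G) (U\<^sup>+)"
    by (auto simp: U_def refl_on_def)
  ultimately have equiv: "equiv (verts G) (U\<^sup>+)"
    by (intro equivI sym_trancl trans_trancl)
  \<comment> \<open>Letters are compared by the full closure \<open>U\<^sup>+\<close> even when
    \<open>(u, v)\<close> is a single link, so the property is the same throughout the induction
    along a chain.\<close>
  define resp where "resp u v \<longleftrightarrow> lab G u = lab G v \<and>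
      list_all2 (\<lambda>x y. (x, y) \<in> U\<^sup>+) (args G u) (args G v) \<and>
      list_all2 (\<lambda>x y. (x, y) \<in> U\<^sup>+) (apfx G u) (apfx G v)" for u v
  have resp_U: "resp u v" if uv: "(u, v) \<in> U" for u v
  proof (cases "(u, v) \<in> Id_on (verts G)")
    case True
    then have "u = v" "u \<in> verts G" by auto
    have "(x, x) \<in> U\<^sup>+" if "x \<in> verts G" for x
      using that by (auto simp: U_def)
    then show ?thesis
      using lho_graph_lists[OF G \<open>u \<in> verts G\<close>] \<open>u = v\<close>
      by (auto simp: resp_def subset_iff intro!: list.rel_refl_strong)
  next
    case False
    then obtain R where R: "R \<in> \<R>" "(u, v) \<in> R"
      using uv by (auto simp: U_def)
    have "(x, y) \<in> U\<^sup>+" if "(x, y) \<in> R" for x y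
      using that R(1) by (auto simp: U_def)
    then show ?thesis
      using \<R>[OF R(1)] R(2) unfolding lho_cong_def resp_def by (auto elim!: list_all2_mono)
  qed
  have list_trans: "list_all2 (\<lambda>x y. (x, y) \<in> U\<^sup>+) xs zs"
    if "list_all2 (\<lambda>x y. (x, y) \<in> U\<^sup>+) xs ys" "list_all2 (\<lambda>x y. (x, y) \<in> U\<^sup>+) ys zs"
    for xs ys zs
    by (rule list_all2_trans[OF _ that]) (rule trancl_trans)
  have "resp u v" if "(u, v) \<in> U\<^sup>+" for u v
    using that
  proof induction
    case (step v w)
    then show ?case
      using resp_U[OF step.hyps(2)] list_trans unfolding resp_def by metis
  qed (rule resp_U)
  with equiv show ?thesis
    unfolding lho_cong_def resp_def U_def cong_Sup_def by blast
qed

theorem theorem8p7: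
  fixes G :: "'v lho_graph"
  assumes "is_lho_graph G"
    and "eager_scope G"
  shows "complete_lattice (image_order G)"
proof -
  note G = assms(1)
  let ?L = "image_order G" and ?c = "quotient_class G"
  have carrier: "carrier ?L = ?c ` {R. lho_cong G R}" and le: "le ?L = class_le"
    and eq: "eq ?L = (=)"
    by (simp_all add: image_order_def image_classes_eq[OF G])
  note le_iff = class_le_quotient_class[OF G]
  \<comment> \<open>Every set of classes comes from a set of congruences, so bounds can be computed
    among congruences under inclusion.\<close>
  have preimage: "\<exists>\<R>. (\<forall>R \<in> \<R>. lho_cong G R) \<and> A = ?c ` \<R>" if "A \<subseteq> carrier ?L" for A
    using that unfolding carrier subset_image_iff by blast
  have order: "partial_order ?L"
  proof
    fix x y assume x: "x \<in> carrier ?L" and y: "y \<in> carrier ?L"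
    show "x .=\<^bsub>?L\<^esub> y" if "x \<sqsubseteq>\<^bsub>?L\<^esub> y" "y \<sqsubseteq>\<^bsub>?L\<^esub> x"
      using that x y by (auto simp: carrier le eq le_iff)
  next
    fix x y z assume "x \<in> carrier ?L" "y \<in> carrier ?L" "z \<in> carrier ?L"
    then show "x \<sqsubseteq>\<^bsub>?L\<^esub> z" if "x \<sqsubseteq>\<^bsub>?L\<^esub> y" "y \<sqsubseteq>\<^bsub>?L\<^esub> z"
      using that by (auto simp: carrier le le_iff)
  qed (auto simp: carrier le eq le_iff)
  show ?thesis
  proof (rule partial_order.complete_latticeI[OF order])
    fix A assume sub: "A \<subseteq> carrier ?L"
    obtain \<R> where \<R>: "\<forall>R \<in> \<R>. lho_cong G R" and A: "A = ?c ` \<R>"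
      using preimage[OF sub] by (elim exE conjE)
    have "Upper ?L A = {u \<in> carrier ?L. \<forall>x \<in> A. class_le x u}"
      using sub by (auto simp: Upper_def le)
    \<comment> \<open>As the order of classes reflects inclusion, upper bounds of \<open>A\<close>
      are the classes of congruences containing every member of \<R>.\<close>
    also have "\<dots> = ?c ` {T. lho_cong G T \<and> (\<forall>R \<in> \<R>. R \<subseteq> T)}"
      using \<R> by (auto simp: A carrier le_iff intro!: imageI; blast)
    finally have Upper: "Upper ?L A = ?c ` {T. lho_cong G T \<and> (\<forall>R \<in> \<R>. R \<subseteq> T)}" .
    have cong: "lho_cong G (cong_Sup G \<R>)"
      using \<R> by (intro lho_cong_Sup[OF G]) blast
    have "cong_Sup G \<R> \<subseteq> T" if "lho_cong G T" "\<forall>R \<in> \<R>. R \<subseteq> T" for T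
      using that by (intro cong_Sup_least) blast+
    then have "least ?L (?c (cong_Sup G \<R>)) (Upper ?L A)"
      unfolding least_def Upper using cong cong_Sup_upper[of _ \<R> G]
      by (simp add: carrier le le_iff image_subset_iff)
    then show "\<exists>s. least ?L s (Upper ?L A)" ..
  next
    fix A assume sub: "A \<subseteq> carrier ?L"
    obtain \<R> where \<R>: "\<forall>R \<in> \<R>. lho_cong G R" and A: "A = ?c ` \<R>"
      using preimage[OF sub] by (elim exE conjE)
    \<comment> \<open>The infimum is built as the supremum of all lower bounds. For empty \<R> this
      is the supremum of all congruences, whereas the intersection of the empty family need not be a
      congruence.\<close>
    let ?B = "{R. lho_cong G R \<and> (\<forall>T \<in> \<R>. R \<subseteq> T)}"
    have "Lower ?L A = {u \<in> carrier ?L. \<forall>x \<in> A. class_le u x}"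
      using sub by (auto simp: Lower_def le)
    also have "\<dots> = ?c ` ?B"
      using \<R> by (auto simp: A carrier le_iff intro!: imageI; blast)
    finally have Lower: "Lower ?L A = ?c ` ?B" .
    have cong: "lho_cong G (cong_Sup G ?B)"
      by (rule lho_cong_Sup[OF G]) simp
    \<comment> \<open>Each member of \<R> is an upper bound of \<open>?B\<close>, so the supremum of
      \<open>?B\<close> is itself a lower bound of \<R>.\<close>
    have "cong_Sup G ?B \<subseteq> R" if "R \<in> \<R>" for R
      using \<R> that by (intro cong_Sup_least) blast+
    then have "cong_Sup G ?B \<in> ?B"
      using cong by blast
    then have "greatest ?L (?c (cong_Sup G ?B)) (Lower ?L A)"
      unfolding greatest_def Lower using cong cong_Sup_upper[of _ ?B G]
      by (simp add: carrier le le_iff image_subset_iff)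
    then show "\<exists>i. greatest ?L i (Lower ?L A)" ..
  qed
qed

end
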